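(* Let $\mathcal{M}=(Q,\Sigma,\cdot,\circ)$ be an invertible Mealy automaton. Then the set $\kappa\subseteq\Sigma^{\omega}$ of singular points of $\mathcal{M}$ has measure zero (with respect to the uniform measure $\mu$ on $\Sigma^{\omega}$).
   Context: A Mealy automaton is $\mathcal{M}=(Q,\Sigma,\cdot,\circ)$ with finite nonempty sets $Q$ (states) and $\Sigma$ (alphabet), a transition function $Q\times\Sigma\to Q$, $(q,a)\mapsto q\cdot a$, and a production function $Q\times\Sigma\to\Sigma$, $(q,a)\mapsto q\circ a$. The production function is extended to words by $q\circ(a_1\cdots a_n)=(q\circ a_1)\big((q\cdot a_1)\circ(a_2\cdots a_n)\big)$. The automaton is invertible if for each $q\in Q$ the map $a\mapsto q\circ a$ is a permutation of $\Sigma$; then each $q$ acts as an automorphism of the rooted regular tree $\Sigma^*$, and $\langle\mathcal{M}\rangle$ denotes the group generated by these automorphisms. It acts also on the boundary $\Sigma^{\omega}$ (right-infinite words, with the product topology). $\mu$ is the uniform (Bernoulli) probability measure on $\Sigma^\omega$: each cylinder $w\Sigma^\omega$ with $|w|=k$ has measure $|\Sigma|^{-k}$. $Sub(\langle\mathcal{M}\rangle)$ is the set of subgroups of $\langle\mathcal{M}\rangle$ with the topology induced by the product (Tikhonov) topology of $\{0,1\}^{\langle\mathcal{M}\rangle}$ (a subgroup being identified with its characteristic function). A point $\xi\in\Sigma^\omega$ is singular if the map $\Sigma^\omega\to Sub(\langle\mathcal{M}\rangle)$, $\xi\mapsto \mathrm{Stab}(\xi)=\{g\in\langle\mathcal{M}\rangle: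 g\circ\xi=\xi\}$, is not continuous at $\xi$. The set of singular points is $\kappa$. *)

theory Defs
  imports "HOL-Probability.Probability" "HOL-Algebra.Generated_Groups" "HOL-Algebra.Bij"
begin

text \<open>The finite nonempty sets of states and of letters are the universes of types of class
  \<open>finite\<close>.  \<open>trans M q a\<close> is \<open>q \<cdot> a\<close> and \<open>out M q a\<close> is \<open>q \<circ> a\<close>.\<close>

record ('q, 'a) mealy =
  trans :: "'q \<Rightarrow> 'a \<Rightarrow> 'q"
  out :: "'q \<Rightarrow> 'a \<Rightarrow> 'a"

definition invertible_mealy :: "('q, 'a) mealy \<Rightarrow> bool" where
  "invertible_mealy M \<longleftrightarrow> (\<forall>q. bij (out M q))"

fun word_act :: "('q, 'a) mealy \<Rightarrow> 'q \<Rightarrow> 'a list \<Rightarrow> 'a list" where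
  "word_act M q [] = []"
| "word_act M q (a # w) = out M q a # word_act M (trans M q a) w"

text \<open>The group \<open>\<langle>M\<rangle>\<close>, inside the group of all bijections of the set of finite words.
  The constant \<^const>\<open>subgroup_generated\<close> silently discards generators outside the ambient
  group; for invertible \<open>M\<close> there are none (lemma \<open>word_act_in_mealy_group\<close> below).\<close>

definition mealy_group :: "('q, 'a) mealy \<Rightarrow> ('a list \<Rightarrow> 'a list) monoid" where
  "mealy_group M = subgroup_generated (BijGroup UNIV) (range (word_act M))"

text \<open>The boundary action of a tree automorphism \<open>g\<close>: the letter at position \<open>n\<close> of \<open>g \<circ> \<xi>\<close> is read
  off from the image of the prefix of \<open>\<xi>\<close> of length \<open>n + 1\<close>.  Every prefix of \<open>g \<circ> \<xi>\<close> is the image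
  of the corresponding prefix of \<open>\<xi>\<close> (lemma \<open>boundary_act_prefix\<close> below).\<close>

definition boundary_act :: "('a list \<Rightarrow> 'a list) \<Rightarrow> (nat \<Rightarrow> 'a) \<Rightarrow> (nat \<Rightarrow> 'a)" where
  "boundary_act g \<xi> = (\<lambda>n. g (map \<xi> [0..<Suc n]) ! n)"

definition stabilizer :: "('q, 'a) mealy \<Rightarrow> (nat \<Rightarrow> 'a) \<Rightarrow> ('a list \<Rightarrow> 'a list) set" where
  "stabilizer M \<xi> = {g \<in> carrier (mealy_group M). boundary_act g \<xi> = \<xi>}"

definition boundary_topology :: "(nat \<Rightarrow> 'a) topology" where
  "boundary_topology = product_topology (\<lambda>_. discrete_topology UNIV) UNIV"

definition uniform_boundary_measure :: "(nat \<Rightarrow> 'a::finite) measure" where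
  "uniform_boundary_measure = PiM UNIV (\<lambda>_. uniform_count_measure UNIV)"

text \<open>The topology on the set of subgroups of \<open>G\<close> induced, via characteristic functions, by
  the product topology on \<open>{0,1}\<^sup>G\<close>, where \<open>{0,1}\<close> is the discrete space of truth values.\<close>

definition Sub_topology :: "('g, 'b) monoid_scheme \<Rightarrow> 'g set topology" where
  "Sub_topology G =
     pullback_topology {H. subgroup H G} (\<lambda>H. \<lambda>g\<in>carrier G. g \<in> H)
       (product_topology (\<lambda>_. discrete_topology (UNIV :: bool set)) (carrier G))"

definition singular_points :: "('q, 'a) mealy \<Rightarrow> (nat \<Rightarrow> 'a) set" where
  "singular_points M =
     {\<xi>. \<not> topcontinuous_at boundary_topology (Sub_topology (mealy_group M)) (stabilizer M) \<xi>}"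

lemma topspace_boundary_topology [simp]: "topspace boundary_topology = UNIV"
  by (simp add: boundary_topology_def)

lemma topspace_Sub_topology [simp]: "topspace (Sub_topology G) = {H. subgroup H G}"
  by (auto simp: Sub_topology_def topspace_pullback_topology)

lemma emeasure_cylinder:
  "emeasure uniform_boundary_measure {\<xi> :: nat \<Rightarrow> 'a::finite. map \<xi> [0..<length w] = w}
     = ennreal ((1 / real CARD('a)) ^ length w)"
proof -
  let ?U = "uniform_count_measure (UNIV :: 'a set)"
  interpret prob_space ?U
    by (rule prob_space_uniform_count_measure) auto
  interpret product_prob_space "\<lambda>_::nat. ?U" UNIV
    by unfold_locales
  have eq: "{\<xi> :: nat \<Rightarrow> 'a. map \<xi> [0..<length w] = w} =
      prod_emb UNIV (\<lambda>_. ?U) {..<length w} (\<Pi>\<^sub>E i\<in>{..<length w}. {w ! i})"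
  proof (rule Set.set_eqI)
    fix \<xi> :: "nat \<Rightarrow> 'a"
    have "map \<xi> [0..<length w] = w \<longleftrightarrow> (\<forall>i\<in>{..<length w}. \<xi> i \<in> {w ! i})"
      unfolding list_eq_iff_nth_eq by (simp add: Ball_def)
    also have "\<dots> \<longleftrightarrow> restrict \<xi> {..<length w} \<in> (\<Pi>\<^sub>E i\<in>{..<length w}. {w ! i})"
      unfolding restrict_PiE_iff ..
    also have "\<dots> \<longleftrightarrow>
        \<xi> \<in> prod_emb UNIV (\<lambda>_. ?U) {..<length w} (\<Pi>\<^sub>E i\<in>{..<length w}. {w ! i})"
      unfolding prod_emb_iff by (simp only: space_uniform_count_measure) simp
    finally show "\<xi> \<in> {\<xi>. map \<xi> [0..<length w] = w} \<longleftrightarrow>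
        \<xi> \<in> prod_emb UNIV (\<lambda>_. ?U) {..<length w} (\<Pi>\<^sub>E i\<in>{..<length w}. {w ! i})"
      by (simp only: mem_Collect_eq)
  qed
  have "emeasure uniform_boundary_measure {\<xi> :: nat \<Rightarrow> 'a. map \<xi> [0..<length w] = w} =
      (\<Prod>i<length w. emeasure ?U {w ! i})"
    unfolding eq uniform_boundary_measure_def
    by (rule emeasure_PiM_emb) (auto simp: sets_uniform_count_measure)
  also have "\<dots> = (\<Prod>i<length w. ennreal (1 / real CARD('a)))"
    by (intro prod.cong) (auto simp: emeasure_uniform_count_measure)
  also have "\<dots> = ennreal ((1 / real CARD('a)) ^ length w)"
    by (simp add: ennreal_power)
  finally show ?thesis .
qed

lemma length_word_act [simp]: "length (word_act M q w) = length w"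
  by (induction w arbitrary: q) auto

lemma take_word_act: "take n (word_act M q w) = word_act M q (take n w)"
  by (induction w arbitrary: q n) (auto simp: take_Cons split: nat.splits)

lemma bij_word_act:
  assumes "invertible_mealy M"
  shows "bij (word_act M q)"
proof -
  have b: "bij (out M q)" for q
    using assms by (simp add: invertible_mealy_def)
  have "inj (word_act M q)"
  proof (rule injI)
    fix u v
    show "word_act M q u = word_act M q v \<Longrightarrow> u = v"
    proof (induction u arbitrary: q v)
      case Nil
      then show ?case by (cases v) auto
    next
      case (Cons a u)
      show ?case
      proof (cases v)
        case Nil
        with Cons.prems show ?thesis by simp
      next
        case v: (Cons c v')
        from Cons.prems v have "out M q a = out M q c" by simp
        then have "a = c" using b by (meson bij_is_inj injD)
        with Cons.prems Cons.IH v show ?thesis by simp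
      qed
    qed
  qed
  moreover have "\<exists>u. word_act M q u = v" for v
  proof (induction v arbitrary: q)
    case Nil
    show ?case by (rule exI[of _ "[]"]) simp
  next
    case (Cons a v)
    obtain x where x: "out M q x = a" using bij_is_surj[OF b] by (metis surjD)
    obtain u where "word_act M (trans M q x) u = v" using Cons by blast
    with x show ?case by (intro exI[of _ "x # u"]) simp
  qed
  ultimately show ?thesis by (metis bijI surjI)
qed

lemma carrier_mealy_group:
  assumes "invertible_mealy M"
  shows "carrier (mealy_group M) = generate (BijGroup UNIV) (range (word_act M))"
proof -
  have "range (word_act M) \<subseteq> carrier (BijGroup UNIV)"
    using bij_word_act[OF assms] by (auto simp: BijGroup_def Bij_def)
  then show ?thesis
    by (simp add: mealy_group_def carrier_subgroup_generated Int_absorb1)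
qed

lemma word_act_in_mealy_group:
  "invertible_mealy M \<Longrightarrow> word_act M q \<in> carrier (mealy_group M)"
  by (simp add: carrier_mealy_group generate.incl)

lemma mealy_group_bij: "g \<in> carrier (mealy_group M) \<Longrightarrow> bij g"
  using group.carrier_subgroup_generated_subset[OF group_BijGroup]
  unfolding mealy_group_def by (fastforce simp: BijGroup_def Bij_def)

lemma group_mealy_group: "group (mealy_group M)"
  by (simp add: mealy_group_def group_BijGroup group.group_subgroup_generated)

lemma mult_mealy_group:
  assumes "g \<in> carrier (mealy_group M)" "h \<in> carrier (mealy_group M)"
  shows "g \<otimes>\<^bsub>mealy_group M\<^esub> h = g \<circ> h"
  using assms[THEN mealy_group_bij]
  by (auto simp: mealy_group_def BijGroup_def Bij_def compose_def)

lemma one_mealy_group: "\<one>\<^bsub>mealy_group M\<^esub> = id"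
  by (auto simp: mealy_group_def BijGroup_def)

lemma mealy_group_length_take:
  fixes M :: "('q, 'a) mealy"
  assumes "g \<in> carrier (mealy_group M)"
  shows "length (g w) = length w \<and> take n (g w) = g (take n w)"
proof -
  let ?B = "BijGroup (UNIV :: 'a list set)"
  let ?A = "{g \<in> carrier ?B. \<forall>w n. length (g w) = length w \<and> take n (g w) = g (take n w)}"
  have inv: "inv\<^bsub>?B\<^esub> g \<in> ?A" if "g \<in> ?A" for g
  proof -
    from that have g: "g \<in> carrier ?B" and b: "bij g"
      and l: "\<And>w. length (g w) = length w" and t: "\<And>n w. take n (g w) = g (take n w)"
      by (auto simp: BijGroup_def Bij_def)
    have e: "inv\<^bsub>?B\<^esub> g = inv_into UNIV g"
      using inv_BijGroup[of g UNIV] g by (simp add: BijGroup_def restrict_UNIV)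
    have "length (inv_into UNIV g w) = length w \<and> take n (inv_into UNIV g w) = inv_into UNIV g (take n w)" for w n
    proof -
      have gi: "g (inv_into UNIV g w) = w" using b by (simp add: bij_is_surj surj_f_inv_f)
      have ig: "inv_into UNIV g (g u) = u" for u using b by (simp add: bij_is_inj inv_f_f)
      have "length (inv_into UNIV g w) = length w" using l[of "inv_into UNIV g w"] gi by simp
      moreover have "take n w = g (take n (inv_into UNIV g w))" using t[of n "inv_into UNIV g w"] gi by simp
      ultimately show ?thesis using ig by simp
    qed
    moreover have "inv\<^bsub>?B\<^esub> g \<in> carrier ?B"
      by (rule group.inv_closed[OF group_BijGroup g])
    ultimately show ?thesis by (simp add: e)
  qed
  have "subgroup ?A ?B"
  proof (rule group.subgroupI[OF group_BijGroup])
    have "id \<in> ?A" by (auto simp: BijGroup_def Bij_def)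
    then show "?A \<noteq> {}" by blast
    show "g \<otimes>\<^bsub>?B\<^esub> h \<in> ?A" if "g \<in> ?A" "h \<in> ?A" for g h
    proof -
      have "g \<otimes>\<^bsub>?B\<^esub> h \<in> carrier ?B"
        using that by (intro monoid.m_closed group.is_monoid group_BijGroup) auto
      then show ?thesis using that by (auto simp: BijGroup_def compose_def)
    qed
  qed (use inv in auto)
  moreover have "carrier ?B \<inter> range (word_act M) \<subseteq> ?A"
    by (auto simp: take_word_act)
  ultimately have "generate ?B (carrier ?B \<inter> range (word_act M)) \<subseteq> ?A"
    by (intro group.generate_subgroup_incl group_BijGroup)
  with assms show ?thesis
    by (auto simp: mealy_group_def carrier_subgroup_generated)
qed

lemma boundary_act_prefix:
  assumes "g \<in> carrier (mealy_group M)"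
  shows "map (boundary_act g \<xi>) [0..<n] = g (map \<xi> [0..<n])"
proof (rule nth_equalityI)
  show "length (map (boundary_act g \<xi>) [0..<n]) = length (g (map \<xi> [0..<n]))"
    using mealy_group_length_take[OF assms] by simp
next
  fix i assume "i < length (map (boundary_act g \<xi>) [0..<n])"
  then have i: "i < n" by simp
  have "map \<xi> [0..<Suc i] = take (Suc i) (map \<xi> [0..<n])"
    using i by (simp add: take_map take_upt del: upt_Suc)
  then have "g (map \<xi> [0..<Suc i]) = take (Suc i) (g (map \<xi> [0..<n]))"
    using mealy_group_length_take[OF assms] by metis
  then show "map (boundary_act g \<xi>) [0..<n] ! i = g (map \<xi> [0..<n]) ! i"
    using i by (simp add: boundary_act_def del: upt_Suc)
qed

lemma boundary_act_id [simp]: "boundary_act id \<xi> = \<xi>"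
  by (simp add: boundary_act_def fun_eq_iff del: upt_Suc)

lemma boundary_act_comp:
  assumes "h \<in> carrier (mealy_group M)"
  shows "boundary_act (g \<circ> h) \<xi> = boundary_act g (boundary_act h \<xi>)"
  using boundary_act_prefix[OF assms]
  by (simp add: boundary_act_def[of g] boundary_act_def[of "g \<circ> h"] del: upt_Suc)

lemma subgroup_stabilizer: "subgroup (stabilizer M \<xi>) (mealy_group M)"
proof (rule group.subgroupI[OF group_mealy_group])
  let ?G = "mealy_group M"
  interpret group ?G by (rule group_mealy_group)
  show "stabilizer M \<xi> \<subseteq> carrier ?G" by (auto simp: stabilizer_def)
  have "\<one>\<^bsub>?G\<^esub> \<in> stabilizer M \<xi>"
    unfolding stabilizer_def using one_closed by (simp add: one_mealy_group)
  then show "stabilizer M \<xi> \<noteq> {}" by blast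
  show "g \<otimes>\<^bsub>?G\<^esub> h \<in> stabilizer M \<xi>"
    if "g \<in> stabilizer M \<xi>" "h \<in> stabilizer M \<xi>" for g h
  proof -
    have g: "g \<in> carrier ?G" "boundary_act g \<xi> = \<xi>"
      and h: "h \<in> carrier ?G" "boundary_act h \<xi> = \<xi>"
      using that by (auto simp: stabilizer_def)
    show ?thesis
      using m_closed[OF g(1) h(1)] boundary_act_comp[OF h(1), of g \<xi>] g h
      by (simp add: stabilizer_def mult_mealy_group)
  qed
  show "inv\<^bsub>?G\<^esub> g \<in> stabilizer M \<xi>" if "g \<in> stabilizer M \<xi>" for g
  proof -
    have g: "g \<in> carrier ?G" "boundary_act g \<xi> = \<xi>"
      using that by (auto simp: stabilizer_def)
    have i: "inv\<^bsub>?G\<^esub> g \<in> carrier ?G" using g by simp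
    have "(inv\<^bsub>?G\<^esub> g) \<circ> g = id"
      using l_inv[OF g(1)] mult_mealy_group[OF i g(1)] by (simp add: one_mealy_group)
    then have "boundary_act (inv\<^bsub>?G\<^esub> g) \<xi> = \<xi>"
      using boundary_act_comp[OF g(1), of "inv\<^bsub>?G\<^esub> g" \<xi>] g(2) by simp
    with i show ?thesis by (simp add: stabilizer_def)
  qed
qed

text \<open>Since stabilizers are subgroups, the range condition that is part of
  \<^const>\<open>topcontinuous_at\<close> always holds, and a point is singular only through the failure of
  continuity proper.\<close>

lemma stabilizer_funcset:
  "stabilizer M \<in> topspace boundary_topology \<rightarrow> topspace (Sub_topology (mealy_group M))"
  by (simp add: subgroup_stabilizer)

end

theory Submission
  imports Defs
begin

text \<open>Write \<open>G\<close> for the group of the automaton.  The topology on subgroups is that of pointwise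
  convergence of characteristic functions, so the stabilizer map is continuous at \<open>\<xi>\<close> iff, for each
  \<open>g\<close> in \<open>G\<close> separately, the truth value of \<open>g \<circ> \<eta> = \<eta>\<close> is constant for \<open>\<eta>\<close> near \<open>\<xi>\<close>.  If \<open>g\<close> moves
  \<open>\<xi>\<close>, then it moves a finite initial word of \<open>\<xi>\<close>, and constancy is automatic.  Hence \<open>\<xi>\<close> is singular
  iff some \<open>g\<close> fixes \<open>\<xi>\<close> without fixing all points of any neighbourhood of \<open>\<xi>\<close>; equivalently, every
  initial word of \<open>\<xi>\<close> lies in the set \<^emph>\<open>T\<close> of words \<open>w\<close> that \<open>g\<close> fixes although it moves some
  extension of \<open>w\<close>.  This is lemma \<open>singular_points_eq\<close>.

  As \<open>G\<close> is countable, it is enough to treat one \<open>g\<close>.  Here finiteness of the automaton enters: the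
  action of \<open>g\<close> below a word \<open>w\<close>, its section at \<open>w\<close>, takes only finitely many values as \<open>w\<close> varies
  (lemma \<open>finite_tree_sections\<close>).  Therefore one length \<open>K\<close> suffices to detect that a section is
  nontrivial: every word of \<^emph>\<open>T\<close> has an extension by exactly \<open>K\<close> letters that \<open>g\<close> moves and which
  thus lies outside \<^emph>\<open>T\<close> (lemma \<open>fixed_frontier_escape\<close>).  If the initial words of a
  random point have stayed in \<^emph>\<open>T\<close> so far, then the next \<open>K\<close> letters lead out of \<^emph>\<open>T\<close> with probability
  at least \<open>c\<^sup>-\<^sup>K\<close>, where \<open>c\<close> is the size of the alphabet; so they stay in \<^emph>\<open>T\<close> forever with
  probability zero (lemma
  \<open>null_sets_uniform_escape\<close>).\<close>

section \<open>Sets of words from which one can escape\<close>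

abbreviation initial_word :: "(nat \<Rightarrow> 'a) \<Rightarrow> nat \<Rightarrow> 'a list" where
  "initial_word \<xi> n \<equiv> map \<xi> [0..<n]"

lemma take_initial_word: "m \<le> n \<Longrightarrow> take m (initial_word \<xi> n) = initial_word \<xi> m"
  by (simp add: take_map)

lemma emeasure_finite_cylinder_union:
  fixes W :: "'a::finite list set"
  assumes "finite W" "\<And>w. w \<in> W \<Longrightarrow> length w = n"
  shows "{\<xi>. initial_word \<xi> n \<in> W} \<in> sets uniform_boundary_measure"
    and "emeasure uniform_boundary_measure {\<xi>. initial_word \<xi> n \<in> W}
           \<le> ennreal (card W * (1 / CARD('a)) ^ n)"
proof -
  have cyl: "{\<xi>. initial_word \<xi> n = w} \<in> sets uniform_boundary_measure"
       "emeasure uniform_boundary_measure {\<xi>. initial_word \<xi> n = w} = ennreal ((1 / CARD('a)) ^ n)"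
    if "w \<in> W" for w
  proof -
    show e: "emeasure uniform_boundary_measure {\<xi>. initial_word \<xi> n = w} =
        ennreal ((1 / CARD('a)) ^ n)"
      using emeasure_cylinder[of w] assms(2)[OF that] by simp
    \<comment> \<open>\<^term>\<open>emeasure\<close> vanishes on sets that are not measurable, and cylinders have positive measure.\<close>
    show "{\<xi>. initial_word \<xi> n = w} \<in> sets uniform_boundary_measure"
    proof (rule ccontr)
      assume "{\<xi>. initial_word \<xi> n = w} \<notin> sets uniform_boundary_measure"
      then have "ennreal ((1 / CARD('a)) ^ n) = 0"
        using e emeasure_notin_sets by metis
      moreover have "(1 / real CARD('a)) ^ n > 0"
        by simp
      ultimately show False
        unfolding ennreal_eq_0_iff by (meson not_le)
    qed
  qed
  have eq: "{\<xi>. initial_word \<xi> n \<in> W} = (\<Union>w\<in>W. {\<xi>. initial_word \<xi> n = w})"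
    by (auto simp del: map_eq_conv)
  show "{\<xi>. initial_word \<xi> n \<in> W} \<in> sets uniform_boundary_measure"
    unfolding eq using assms(1) cyl(1) by (intro sets.finite_UN)
  have "emeasure uniform_boundary_measure {\<xi>. initial_word \<xi> n \<in> W}
      \<le> (\<Sum>w\<in>W. emeasure uniform_boundary_measure {\<xi>. initial_word \<xi> n = w})"
    unfolding eq using assms(1) cyl(1) by (intro emeasure_subadditive_finite) auto
  also have "\<dots> = (\<Sum>w\<in>W. ennreal ((1 / CARD('a)) ^ n))"
    by (intro sum.cong refl cyl(2))
  also have "\<dots> = ennreal (card W * (1 / CARD('a)) ^ n)"
    by (subst sum_ennreal) auto
  finally show "emeasure uniform_boundary_measure {\<xi>. initial_word \<xi> n \<in> W}
      \<le> ennreal (card W * (1 / CARD('a)) ^ n)" .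
qed

lemma finite_words_of_length: "finite {w :: 'a::finite list. length w = n \<and> P w}"
  by (rule finite_subset[OF _ finite_lists_length_eq[of UNIV n]]) auto

text \<open>Each surviving word of length \<open>n * K\<close> has at most \<open>c\<^sup>K - 1\<close> surviving extensions by \<open>K\<close> letters,
  because at least one of its \<open>c\<^sup>K\<close> extensions has left \<^emph>\<open>T\<close>.\<close>

lemma card_surviving_words:
  fixes T :: "'a::finite list set"
  assumes "\<And>w. w \<in> T \<Longrightarrow> \<exists>v. length v = K \<and> w @ v \<notin> T"
  shows "card {w. length w = n * K \<and> (\<forall>m\<le>n. take (m * K) w \<in> T)} \<le> (CARD('a) ^ K - 1) ^ n"
proof (induction n)
  case 0
  have "card {w. length w = 0 * K \<and> (\<forall>m\<le>0. take (m * K) w \<in> T)} \<le> card {[] :: 'a list}"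
    by (intro card_mono) auto
  then show ?case by simp
next
  case (Suc n)
  define S where "S n = {w. length w = n * K \<and> (\<forall>m\<le>n. take (m * K) w \<in> T)}" for n
  have finS: "finite (S n)" for n
    unfolding S_def by (rule finite_words_of_length)
  obtain e where e: "\<And>w. w \<in> T \<Longrightarrow> length (e w) = K" "\<And>w. w \<in> T \<Longrightarrow> w @ e w \<notin> T"
    using assms by metis
  define L where "L = {v :: 'a list. length v = K}"
  have finL: "finite L" and cardL: "card L = CARD('a) ^ K"
    using finite_lists_length_eq[of "UNIV :: 'a set" K] card_lists_length_eq[of "UNIV :: 'a set" K]
    by (simp_all add: L_def)
  have "S (Suc n) \<subseteq> (\<lambda>(w, v). w @ v) ` (SIGMA w:S n. L - {e w})"
  proof
    fix x assume x: "x \<in> S (Suc n)"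
    define w v where "w = take (n * K) x" and "v = drop (n * K) x"
    have xwv: "x = w @ v" and len: "length w = n * K" "length v = K"
      using x by (auto simp: w_def v_def S_def)
    have "take (m * K) w \<in> T" if "m \<le> n" for m
    proof -
      have "take (m * K) w = take (m * K) x"
        using that by (simp add: w_def min_def)
      then show ?thesis using x that by (simp add: S_def)
    qed
    then have w: "w \<in> S n" using len by (simp add: S_def)
    have "take (n * K) w \<in> T" using w unfolding S_def by blast
    then have "w \<in> T" using len by simp
    have "take (Suc n * K) x \<in> T" using x unfolding S_def by blast
    then have "x \<in> T" using x by (simp add: S_def)
    then have "v \<noteq> e w" using e(2)[OF \<open>w \<in> T\<close>] xwv by auto
    then show "x \<in> (\<lambda>(w, v). w @ v) ` (SIGMA w:S n. L - {e w})"
      using w len xwv by (force simp: L_def)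
  qed
  then have "card (S (Suc n)) \<le> card ((\<lambda>(w, v). w @ v) ` (SIGMA w:S n. L - {e w}))"
    using finS finL by (intro card_mono finite_imageI finite_SigmaI) auto
  also have "\<dots> \<le> card (SIGMA w:S n. L - {e w})"
    using finS finL by (intro card_image_le finite_SigmaI) auto
  also have "\<dots> = (\<Sum>w\<in>S n. card (L - {e w}))"
    using finS finL by simp
  also have "\<dots> = (\<Sum>w\<in>S n. CARD('a) ^ K - 1)"
  proof (intro sum.cong refl)
    fix w assume w: "w \<in> S n"
    then have "take (n * K) w \<in> T" unfolding S_def by blast
    then have "w \<in> T" using w by (simp add: S_def)
    then show "card (L - {e w}) = CARD('a) ^ K - 1"
      using e(1) finL cardL by (simp add: L_def)
  qed
  also have "\<dots> \<le> (CARD('a) ^ K - 1) ^ Suc n"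
    using Suc.IH by (simp add: S_def)
  finally show ?case by (simp add: S_def)
qed

text \<open>Inspecting the point only at the lengths \<open>n * K\<close>, the counting bound gives survival up to
  time \<open>n\<close> at most the measure \<open>(c\<^sup>K - 1)\<^sup>n / c\<^bsup>n * K\<^esup> = (1 - c\<^sup>-\<^sup>K)\<^sup>n\<close>, which tends to zero.\<close>

lemma null_sets_uniform_escape:
  fixes T :: "'a::finite list set"
  assumes "\<And>w. w \<in> T \<Longrightarrow> \<exists>v. length v = K \<and> w @ v \<notin> T"
  shows "{\<xi>. \<forall>n. initial_word \<xi> n \<in> T} \<in> null_sets uniform_boundary_measure"
proof -
  let ?N = "{\<xi>. \<forall>n. initial_word \<xi> n \<in> T}"
  define c where "c = real CARD('a)"
  have c: "c \<ge> 1" by (simp add: c_def Suc_le_eq)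
  define r where "r = 1 - (1 / c) ^ K"
  have r: "0 \<le> r" "r < 1"
    using c by (simp_all add: r_def power_le_one)
  have "{\<xi>. initial_word \<xi> n \<in> {w. length w = n \<and> w \<in> T}} \<in> sets uniform_boundary_measure"
    for n
    by (rule emeasure_finite_cylinder_union(1)[OF finite_words_of_length]) blast
  then have "{\<xi>. initial_word \<xi> n \<in> T} \<in> sets uniform_boundary_measure" for n
    by simp
  then have "range (\<lambda>n. {\<xi>. initial_word \<xi> n \<in> T}) \<subseteq> sets uniform_boundary_measure"
    by (rule image_subsetI)
  then have "(\<Inter>n. {\<xi>. initial_word \<xi> n \<in> T}) \<in> sets uniform_boundary_measure"
    by (rule sets.countable_INT) (rule UNIV_not_empty)
  moreover have "?N = (\<Inter>n. {\<xi>. initial_word \<xi> n \<in> T})"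
    by auto
  ultimately have meas: "?N \<in> sets uniform_boundary_measure"
    by (simp only:)
  have bound: "emeasure uniform_boundary_measure ?N \<le> ennreal (r ^ n)" for n
  proof -
    define S where "S = {w. length w = n * K \<and> (\<forall>m\<le>n. take (m * K) w \<in> T)}"
    have finS: "finite S" unfolding S_def by (rule finite_words_of_length)
    have lenS: "length w = n * K" if "w \<in> S" for w using that by (simp add: S_def)
    have "?N \<subseteq> {\<xi>. initial_word \<xi> (n * K) \<in> S}"
      by (auto simp: S_def take_initial_word)
    then have "emeasure uniform_boundary_measure ?N
        \<le> emeasure uniform_boundary_measure {\<xi>. initial_word \<xi> (n * K) \<in> S}"
      by (intro emeasure_mono emeasure_finite_cylinder_union finS lenS)
    also have "\<dots> \<le> ennreal (card S * (1 / CARD('a)) ^ (n * K))"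
      by (intro emeasure_finite_cylinder_union finS lenS)
    also have "\<dots> \<le> ennreal (r ^ n)"
    proof (rule ennreal_leI)
      have "real (card S) \<le> real ((CARD('a) ^ K - 1) ^ n)"
        unfolding S_def by (intro of_nat_mono card_surviving_words assms)
      also have "\<dots> = (c ^ K - 1) ^ n"
        by (simp add: c_def of_nat_diff Suc_le_eq)
      finally have "card S * (1 / CARD('a)) ^ (n * K) \<le> (c ^ K - 1) ^ n * (1 / c) ^ (n * K)"
        using c by (intro mult_mono) (auto simp: c_def)
      also have "\<dots> = ((c ^ K - 1) * (1 / c) ^ K) ^ n"
        by (simp add: power_mult_distrib power_mult mult.commute[of n K])
      also have "(c ^ K - 1) * (1 / c) ^ K = r"
        using c by (simp add: r_def power_divide field_simps)
      finally show "card S * (1 / CARD('a)) ^ (n * K) \<le> r ^ n" .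
    qed
    finally show ?thesis .
  qed
  have "(\<lambda>n. ennreal (r ^ n)) \<longlonglongrightarrow> ennreal 0"
    using r by (intro tendsto_ennrealI LIMSEQ_realpow_zero)
  then have "emeasure uniform_boundary_measure ?N \<le> ennreal 0"
    using bound by (intro tendsto_lowerbound) auto
  then show ?thesis using meas by (simp add: null_sets_def)
qed

section \<open>Sections of the elements of an automaton group\<close>

lemma mealy_group_induct [consumes 2, case_names id state inv comp]:
  assumes "invertible_mealy M" "g \<in> carrier (mealy_group M)"
    and "P id"
    and "\<And>q. P (word_act M q)"
    and "\<And>q. inv_into UNIV (word_act M q) \<in> carrier (mealy_group M) \<Longrightarrow>
           P (inv_into UNIV (word_act M q))"
    and "\<And>g h. \<lbrakk>g \<in> carrier (mealy_group M); h \<in> carrier (mealy_group M); P g; P h\<rbrakk> \<Longrightarrow> P (g \<circ> h)"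
  shows "P g"
proof -
  let ?B = "BijGroup (UNIV :: 'b list set)"
  note carrier = carrier_mealy_group[OF assms(1)]
  have "g \<in> generate ?B (range (word_act M))" using assms(2) carrier by simp
  then show ?thesis
  proof induction
    case one
    then show ?case using assms(3) by (simp add: BijGroup_def restrict_UNIV id_def)
  next
    case (incl h)
    then show ?case using assms(4) by auto
  next
    case (inv h)
    then obtain q where q: "h = word_act M q" by auto
    have "inv\<^bsub>?B\<^esub> h = inv_into UNIV h"
      using inv_BijGroup[of h UNIV] bij_word_act[OF assms(1), of q] q
      by (simp add: Bij_def restrict_UNIV)
    then show ?case using assms(5) generate.inv[OF inv, of ?B] carrier q by simp
  next
    case (eng g h)
    then have gh: "g \<in> carrier (mealy_group M)" "h \<in> carrier (mealy_group M)"
      by (simp_all add: carrier)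
    have "g \<otimes>\<^bsub>?B\<^esub> h = g \<circ> h"
      using gh[THEN mealy_group_bij] by (auto simp: BijGroup_def Bij_def compose_def)
    then show ?case using assms(6)[OF gh] eng by (simp only:)
  qed
qed

text \<open>Every element is the product of a finite list of states and inverses of states.\<close>

lemma countable_mealy_group:
  fixes M :: "('q::finite, 'a) mealy"
  assumes "invertible_mealy M"
  shows "countable (carrier (mealy_group M))"
proof -
  let ?S = "range (word_act M) \<union> inv_into UNIV ` range (word_act M)"
  let ?prod = "\<lambda>gs. foldr (\<circ>) gs id"
  have single: "s \<in> ?prod ` lists ?S" if "s \<in> ?S" for s
    using that by (intro image_eqI[of _ _ "[s]"]) auto
  have foldr_comp: "foldr (\<circ>) gs h = ?prod gs \<circ> h" for gs and h :: "'a list \<Rightarrow> 'a list"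
    by (induction gs) (auto simp: comp_assoc)
  have "g \<in> ?prod ` lists ?S" if "g \<in> carrier (mealy_group M)" for g
    using assms that
  proof (induction rule: mealy_group_induct)
    case id
    show ?case by (rule image_eqI[of _ _ "[]"]) auto
  next
    case (comp g h)
    then obtain gs hs where "g = ?prod gs" "h = ?prod hs" "gs \<in> lists ?S" "hs \<in> lists ?S"
      by blast
    then have "g \<circ> h = ?prod (gs @ hs)" "gs @ hs \<in> lists ?S"
      by (simp_all add: foldr_comp[of gs "foldr (\<circ>) hs id"])
    then show ?case by blast
  qed (blast intro: single)+
  then have "carrier (mealy_group M) \<subseteq> ?prod ` lists ?S" by blast
  moreover have "countable (?prod ` lists ?S)"
    by (intro countable_image countable_lists) (simp add: countable_finite)
  ultimately show ?thesis by (rule countable_subset)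
qed

text \<open>For a tree automorphism \<open>g\<close> this is the map usually written \<open>g|\<^sub>w\<close>, the action of \<open>g\<close> on the
  subtree below \<open>w\<close> after both that subtree and the one below \<open>g w\<close> are identified with the whole
  tree.\<close>

definition tree_section :: "('a list \<Rightarrow> 'a list) \<Rightarrow> 'a list \<Rightarrow> 'a list \<Rightarrow> 'a list" where
  "tree_section g w v = drop (length w) (g (w @ v))"

lemma mealy_group_append:
  assumes "g \<in> carrier (mealy_group M)"
  shows "g (w @ v) = g w @ tree_section g w v"
proof -
  have "take (length w) (g (w @ v)) = g w"
    using mealy_group_length_take[OF assms, of "w @ v" "length w"] by simp
  then show ?thesis unfolding tree_section_def by (metis append_take_drop_id)
qed

lemma tree_section_id: "tree_section id w = id"
  by (auto simp: tree_section_def)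

lemma tree_section_comp:
  assumes "h \<in> carrier (mealy_group M)"
  shows "tree_section (g \<circ> h) w = tree_section g (h w) \<circ> tree_section h w"
proof
  fix v
  have "length (h w) = length w" using mealy_group_length_take[OF assms] by blast
  then show "tree_section (g \<circ> h) w v = (tree_section g (h w) \<circ> tree_section h w) v"
    by (simp add: tree_section_def[of "g \<circ> h"] tree_section_def[of g] mealy_group_append[OF assms])
qed

text \<open>The chain rule applied to both composites of \<open>g\<close> with its inverse shows that the two sections
  are inverse to each other.\<close>

lemma tree_section_inv:
  assumes g: "g \<in> carrier (mealy_group M)" and h: "inv_into UNIV g \<in> carrier (mealy_group M)"
  shows "tree_section (inv_into UNIV g) w = inv_into UNIV (tree_section g (inv_into UNIV g w))"
proof -
  let ?h = "inv_into UNIV g"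
  have b: "bij g" using g by (rule mealy_group_bij)
  have gh: "g \<circ> ?h = id" and hg: "?h \<circ> g = id"
    using bij_is_surj[OF b] bij_is_inj[OF b] by (simp_all flip: surj_iff inj_iff)
  have "g (?h w) = w" using gh by (metis comp_apply id_apply)
  then have "tree_section ?h w \<circ> tree_section g (?h w) = id"
    using tree_section_comp[OF g, of ?h "?h w"] hg by (simp add: tree_section_id)
  moreover have "tree_section g (?h w) \<circ> tree_section ?h w = id"
    using tree_section_comp[OF h, of g w] gh by (simp add: tree_section_id)
  ultimately show ?thesis by (simp add: inv_unique_comp)
qed

lemma tree_section_word_act: "\<exists>q'. tree_section (word_act M q) w = word_act M q'"
proof (induction w arbitrary: q)
  case Nil
  show ?case by (rule exI[of _ q]) (simp add: tree_section_def fun_eq_iff)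
next
  case (Cons a w)
  have "tree_section (word_act M q) (a # w) = tree_section (word_act M (trans M q a)) w"
    by (simp add: tree_section_def fun_eq_iff)
  then show ?case using Cons.IH by metis
qed

text \<open>The sections of a generator are again states of the automaton.  The chain rule and its analogue
  for inverses carry finiteness over to all products.\<close>

lemma finite_tree_sections:
  fixes M :: "('q::finite, 'a) mealy"
  assumes "invertible_mealy M" "g \<in> carrier (mealy_group M)"
  shows "finite (range (tree_section g))"
proof -
  have state: "finite (range (tree_section (word_act M q)))" for q
  proof (rule finite_subset)
    show "range (tree_section (word_act M q)) \<subseteq> range (word_act M)"
      using tree_section_word_act by fastforce
  qed simp
  show ?thesis
    using assms
  proof (induction rule: mealy_group_induct)
    case id
    have "range (tree_section id) \<subseteq> {id :: 'a list \<Rightarrow> 'a list}" by (auto simp: tree_section_id)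
    then show ?case by (rule finite_subset) simp
  next
    case (state q)
    show ?case by (rule \<open>finite (range (tree_section (word_act M q)))\<close>)
  next
    case (inv q)
    have "range (tree_section (inv_into UNIV (word_act M q)))
        \<subseteq> inv_into UNIV ` range (tree_section (word_act M q))"
      using tree_section_inv[OF word_act_in_mealy_group[OF assms(1)] inv] by auto
    then show ?case by (rule finite_subset) (intro finite_imageI state)
  next
    case (comp g h)
    have "range (tree_section (g \<circ> h))
        \<subseteq> (\<lambda>(s, t). s \<circ> t) ` (range (tree_section g) \<times> range (tree_section h))"
      using tree_section_comp[OF comp(2), of g] by auto
    then show ?case
      by (rule finite_subset) (intro finite_imageI finite_cartesian_product comp)
  qed
qed

section \<open>The words that an automorphism fixes without fixing the subtree below them\<close>

definition fixed_frontier :: "('a list \<Rightarrow> 'a list) \<Rightarrow> 'a list set" where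
  "fixed_frontier g = {w. g w = w \<and> (\<exists>v. g (w @ v) \<noteq> w @ v)}"

text \<open>Choose for each of the finitely many nontrivial sections a word that it moves, let \<open>K\<close> bound
  the lengths of these words, and pad them to length \<open>K\<close>; an extension of a moved word is moved.\<close>

lemma fixed_frontier_escape:
  fixes M :: "('q::finite, 'a) mealy"
  assumes "invertible_mealy M" and g: "g \<in> carrier (mealy_group M)"
  shows "\<exists>K. \<forall>w\<in>fixed_frontier g. \<exists>v. length v = K \<and> w @ v \<notin> fixed_frontier g"
proof -
  have fixed_iff: "g (w @ v) = w @ v \<longleftrightarrow> tree_section g w v = v" if "g w = w" for w v
    using mealy_group_append[OF g, of w v] that by simp
  \<comment> \<open>At the identity section \<^term>\<open>moved\<close> is an arbitrary word; its length can only enlarge \<open>K\<close>.\<close>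
  define moved where "moved s = (SOME v. s v \<noteq> v)" for s :: "'a list \<Rightarrow> 'a list"
  define K where "K = Max ((length \<circ> moved) ` range (tree_section g))"
  have K: "length (moved (tree_section g w)) \<le> K" for w
    unfolding K_def using finite_tree_sections[OF assms] by (intro Max_ge) auto
  have "\<exists>v. length v = K \<and> w @ v \<notin> fixed_frontier g" if w: "w \<in> fixed_frontier g" for w
  proof -
    let ?u = "moved (tree_section g w)"
    define v where "v = ?u @ replicate (K - length ?u) undefined"
    have gw: "g w = w" and "\<exists>v. tree_section g w v \<noteq> v"
      using w fixed_iff by (auto simp: fixed_frontier_def)
    then have "tree_section g w ?u \<noteq> ?u"
      unfolding moved_def by (metis (mono_tags, lifting) someI_ex)
    then have "g (w @ ?u) \<noteq> w @ ?u" using fixed_iff[OF gw] by simp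
    moreover have "take (length (w @ ?u)) (g (w @ v)) = g (w @ ?u)"
      using mealy_group_length_take[OF g, of "w @ v" "length (w @ ?u)"] by (simp add: v_def)
    ultimately have "g (w @ v) \<noteq> w @ v" by (auto simp: v_def)
    moreover have "length v = K" using K[of w] by (simp add: v_def)
    ultimately show ?thesis by (auto simp: fixed_frontier_def)
  qed
  then show ?thesis by blast
qed

section \<open>Singular points\<close>

lemma openin_boundary_topology:
  "openin boundary_topology U \<longleftrightarrow>
     (\<forall>\<xi>\<in>U. \<exists>n. \<forall>\<eta>. initial_word \<eta> n = initial_word \<xi> n \<longrightarrow> \<eta> \<in> U)"
proof
  assume U: "openin boundary_topology U"
  show "\<forall>\<xi>\<in>U. \<exists>n. \<forall>\<eta>. initial_word \<eta> n = initial_word \<xi> n \<longrightarrow> \<eta> \<in> U"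
  proof
    fix \<xi> assume "\<xi> \<in> U"
    then obtain X where X: "finite {i. X i \<noteq> UNIV}" "\<xi> \<in> Pi\<^sub>E UNIV X" "Pi\<^sub>E UNIV X \<subseteq> U"
      using U unfolding boundary_topology_def openin_product_topology_alt by auto
    obtain n where n: "\<And>i. X i \<noteq> UNIV \<Longrightarrow> i < n"
      using X(1) finite_nat_set_iff_bounded by auto
    have "\<eta> \<in> U" if "initial_word \<eta> n = initial_word \<xi> n" for \<eta>
    proof -
      have "\<eta> i \<in> X i" for i
      proof (cases "X i = UNIV")
        case False
        then have "\<eta> i = \<xi> i" using n that by simp
        then show ?thesis using X(2) by auto
      qed simp
      then show ?thesis using X(3) by auto
    qed
    then show "\<exists>n. \<forall>\<eta>. initial_word \<eta> n = initial_word \<xi> n \<longrightarrow> \<eta> \<in> U" by blast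
  qed
next
  assume U: "\<forall>\<xi>\<in>U. \<exists>n. \<forall>\<eta>. initial_word \<eta> n = initial_word \<xi> n \<longrightarrow> \<eta> \<in> U"
  show "openin boundary_topology U"
    unfolding boundary_topology_def openin_product_topology_alt
  proof
    fix \<xi> assume "\<xi> \<in> U"
    then obtain n where n: "\<And>\<eta>. initial_word \<eta> n = initial_word \<xi> n \<Longrightarrow> \<eta> \<in> U" using U by blast
    define X where "X i = (if i < n then {\<xi> i} else UNIV)" for i
    have "finite {i. X i \<noteq> UNIV}"
      by (rule finite_subset[of _ "{..<n}"]) (auto simp: X_def)
    moreover have "\<xi> \<in> Pi\<^sub>E UNIV X" by (auto simp: X_def)
    moreover have "Pi\<^sub>E UNIV X \<subseteq> U"
    proof
      fix \<eta> assume "\<eta> \<in> Pi\<^sub>E UNIV X"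
      then have "\<eta> i \<in> X i" for i by auto
      then have "\<eta> i = \<xi> i" if "i < n" for i using that by (metis X_def singletonD)
      then show "\<eta> \<in> U" by (intro n) simp
    qed
    ultimately show "\<exists>X. finite {i \<in> UNIV. X i \<noteq> topspace (discrete_topology UNIV)} \<and>
        (\<forall>i\<in>UNIV. openin (discrete_topology UNIV) (X i)) \<and> \<xi> \<in> Pi\<^sub>E UNIV X \<and> Pi\<^sub>E UNIV X \<subseteq> U"
      by (intro exI[of _ X]) simp
  qed
qed

lemma openin_cylinder: "openin boundary_topology {\<eta>. initial_word \<eta> n = initial_word \<xi> n}"
  unfolding openin_boundary_topology by (metis mem_Collect_eq)

text \<open>A basic open set of subgroups constrains the membership of finitely many elements, so
  continuity may be tested on one element at a time.\<close>

lemma topcontinuous_at_Sub_topology: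
  assumes f: "\<And>y. y \<in> topspace X \<Longrightarrow> subgroup (f y) G" and x: "x \<in> topspace X"
  shows "topcontinuous_at X (Sub_topology G) f x \<longleftrightarrow>
    (\<forall>g\<in>carrier G. \<exists>U. openin X U \<and> x \<in> U \<and> (\<forall>y\<in>U. g \<in> f y \<longleftrightarrow> g \<in> f x))"
proof
  assume c: "topcontinuous_at X (Sub_topology G) f x"
  show "\<forall>g\<in>carrier G. \<exists>U. openin X U \<and> x \<in> U \<and> (\<forall>y\<in>U. g \<in> f y \<longleftrightarrow> g \<in> f x)"
  proof
    fix g assume g: "g \<in> carrier G"
    let ?D = "product_topology (\<lambda>_. discrete_topology (UNIV :: bool set)) (carrier G)"
    let ?W = "{\<phi> \<in> topspace ?D. \<phi> g \<in> {g \<in> f x}}"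
    let ?V = "(\<lambda>H. \<lambda>h\<in>carrier G. h \<in> H) -` ?W \<inter> {H. subgroup H G}"
    have "openin ?D ?W"
      by (rule openin_continuous_map_preimage[OF continuous_map_product_projection[OF g]]) simp
    then have "openin (Sub_topology G) ?V"
      unfolding Sub_topology_def openin_pullback_topology by blast
    moreover have V: "H \<in> ?V \<longleftrightarrow> subgroup H G \<and> (g \<in> H \<longleftrightarrow> g \<in> f x)" for H
      using g by auto
    then have "f x \<in> ?V" using f x by blast
    ultimately obtain U where "openin X U" "x \<in> U" "\<forall>y\<in>U. f y \<in> ?V"
      using c unfolding topcontinuous_at_def by blast
    then show "\<exists>U. openin X U \<and> x \<in> U \<and> (\<forall>y\<in>U. g \<in> f y \<longleftrightarrow> g \<in> f x)"
      using V by blast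
  qed
next
  assume loc: "\<forall>g\<in>carrier G. \<exists>U. openin X U \<and> x \<in> U \<and> (\<forall>y\<in>U. g \<in> f y \<longleftrightarrow> g \<in> f x)"
  then obtain U where U: "\<And>g. g \<in> carrier G \<Longrightarrow> openin X (U g)" "\<And>g. g \<in> carrier G \<Longrightarrow> x \<in> U g"
    "\<And>g y. g \<in> carrier G \<Longrightarrow> y \<in> U g \<Longrightarrow> g \<in> f y \<longleftrightarrow> g \<in> f x"
    by metis
  show "topcontinuous_at X (Sub_topology G) f x"
    unfolding topcontinuous_at_def
  proof (intro conjI allI impI)
    show "x \<in> topspace X" by (rule x)
    show "f \<in> topspace X \<rightarrow> topspace (Sub_topology G)" using f by simp
    fix V assume "openin (Sub_topology G) V \<and> f x \<in> V"
    then obtain W where W: "openin (product_topology (\<lambda>_. discrete_topology UNIV) (carrier G)) W"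
      and V: "V = (\<lambda>H. \<lambda>h\<in>carrier G. h \<in> H) -` W \<inter> {H. subgroup H G}" and fx: "f x \<in> V"
      unfolding Sub_topology_def openin_pullback_topology by blast
    have "(\<lambda>h\<in>carrier G. h \<in> f x) \<in> W" using fx V by blast
    then obtain B where B: "finite {g \<in> carrier G. B g \<noteq> UNIV}"
      "(\<lambda>h\<in>carrier G. h \<in> f x) \<in> Pi\<^sub>E (carrier G) B" "Pi\<^sub>E (carrier G) B \<subseteq> W"
      using W unfolding openin_product_topology_alt by fastforce
    \<comment> \<open>Only finitely many coordinates matter, so finitely many neighbourhoods are intersected;
      \<^term>\<open>topspace X\<close> covers the case in which no coordinate matters.\<close>
    define N where "N = \<Inter> (insert (topspace X) (U ` {g \<in> carrier G. B g \<noteq> UNIV}))"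
    have "openin X N" unfolding N_def using B(1) U(1) by (intro openin_Inter) auto
    moreover have "x \<in> N" unfolding N_def using x U(2) by auto
    moreover have "f y \<in> V" if y: "y \<in> N" for y
    proof -
      have "(\<lambda>h\<in>carrier G. h \<in> f y) \<in> Pi\<^sub>E (carrier G) B"
      proof (rule restrict_PiE_iff[THEN iffD2], rule ballI)
        fix g assume g: "g \<in> carrier G"
        show "(g \<in> f y) \<in> B g"
        proof (cases "B g = UNIV")
          case False
          then have "y \<in> U g" using y g by (auto simp: N_def)
          then have "(g \<in> f y) = (g \<in> f x)" using U(3) g by blast
          moreover have "(g \<in> f x) \<in> B g" using B(2) g by (auto simp: restrict_PiE_iff)
          ultimately show ?thesis by simp
        qed simp
      qed
      moreover have "subgroup (f y) G" using y f by (auto simp: N_def)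
      ultimately show ?thesis using V B(3) by blast
    qed
    ultimately show "\<exists>U. openin X U \<and> x \<in> U \<and> (\<forall>y\<in>U. f y \<in> V)" by blast
  qed
qed

lemma boundary_fixed_iff:
  assumes "g \<in> carrier (mealy_group M)"
  shows "boundary_act g \<xi> = \<xi> \<longleftrightarrow> (\<forall>n. g (initial_word \<xi> n) = initial_word \<xi> n)"
proof
  assume "boundary_act g \<xi> = \<xi>"
  then show "\<forall>n. g (initial_word \<xi> n) = initial_word \<xi> n"
    using boundary_act_prefix[OF assms, of \<xi>] by simp
next
  assume r: "\<forall>n. g (initial_word \<xi> n) = initial_word \<xi> n"
  show "boundary_act g \<xi> = \<xi>"
  proof
    fix n
    have "boundary_act g \<xi> n = initial_word \<xi> (Suc n) ! n"
      using r unfolding boundary_act_def by metis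
    then show "boundary_act g \<xi> n = \<xi> n" by (simp del: upt_Suc)
  qed
qed

lemma exists_boundary_extension: "\<exists>\<eta>. initial_word \<eta> (length w) = w"
  by (rule exI[of _ "\<lambda>i. w ! i"]) (rule map_nth)

text \<open>An initial word outside the frontier is either moved by \<open>g\<close>, and then \<open>g\<close> fixes no point of its
  cylinder, or \<open>g\<close> fixes the whole cylinder.  Conversely, if \<open>g\<close> fixes \<open>\<xi>\<close> and a cylinder around it
  pointwise, then it fixes every finite extension of the initial word, as each is an initial word of
  some point of the cylinder.\<close>

lemma locally_constant_fixing_iff:
  assumes g: "g \<in> carrier (mealy_group M)"
  shows "(\<exists>U. openin boundary_topology U \<and> \<xi> \<in> U \<and>
            (\<forall>\<eta>\<in>U. boundary_act g \<eta> = \<eta> \<longleftrightarrow> boundary_act g \<xi> = \<xi>)) \<longleftrightarrow>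
         (\<exists>n. initial_word \<xi> n \<notin> fixed_frontier g)"
proof
  assume "\<exists>U. openin boundary_topology U \<and> \<xi> \<in> U \<and>
      (\<forall>\<eta>\<in>U. boundary_act g \<eta> = \<eta> \<longleftrightarrow> boundary_act g \<xi> = \<xi>)"
  then obtain n where n: "\<And>\<eta>. initial_word \<eta> n = initial_word \<xi> n \<Longrightarrow>
      boundary_act g \<eta> = \<eta> \<longleftrightarrow> boundary_act g \<xi> = \<xi>"
    unfolding openin_boundary_topology by blast
  show "\<exists>n. initial_word \<xi> n \<notin> fixed_frontier g"
  proof (cases "boundary_act g \<xi> = \<xi>")
    case True
    have "g (initial_word \<xi> n @ v) = initial_word \<xi> n @ v" for v
    proof -
      let ?w = "initial_word \<xi> n @ v"
      obtain \<eta> where \<eta>: "initial_word \<eta> (length ?w) = ?w" using exists_boundary_extension by metis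
      have "initial_word \<eta> n = take n ?w"
        using take_initial_word[of n "length ?w" \<eta>] \<eta> by simp
      then have "initial_word \<eta> n = initial_word \<xi> n" by simp
      then have "boundary_act g \<eta> = \<eta>" using n True by blast
      then show ?thesis using boundary_fixed_iff[OF g] \<eta> by metis
    qed
    then show ?thesis unfolding fixed_frontier_def by blast
  next
    case False
    then show ?thesis using boundary_fixed_iff[OF g] by (auto simp: fixed_frontier_def)
  qed
next
  assume "\<exists>n. initial_word \<xi> n \<notin> fixed_frontier g"
  then obtain n where n: "initial_word \<xi> n \<notin> fixed_frontier g" by blast
  have "boundary_act g \<eta> = \<eta> \<longleftrightarrow> boundary_act g \<xi> = \<xi>"
    if \<eta>: "initial_word \<eta> n = initial_word \<xi> n" for \<eta>
  proof (cases "g (initial_word \<xi> n) = initial_word \<xi> n")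
    case False
    then show ?thesis using boundary_fixed_iff[OF g] \<eta> by metis
  next
    case True
    have all: "boundary_act g \<zeta> = \<zeta>" if \<zeta>: "initial_word \<zeta> n = initial_word \<xi> n" for \<zeta>
    proof -
      have "g (initial_word \<zeta> m) = initial_word \<zeta> m" for m
      proof -
        let ?x = "initial_word \<zeta> (n + m)"
        have "?x = initial_word \<xi> n @ drop n ?x"
          using take_initial_word[of n "n + m" \<zeta>] \<zeta> by (metis append_take_drop_id le_add1)
        then have "g ?x = ?x"
          using n True unfolding fixed_frontier_def by (metis (mono_tags, lifting) mem_Collect_eq)
        then show ?thesis
          using mealy_group_length_take[OF g, of ?x m] take_initial_word[of m "n + m" \<zeta>] by simp
      qed
      then show ?thesis using boundary_fixed_iff[OF g] by blast
    qed
    show ?thesis using all[OF \<eta>] all[OF refl] by simp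
  qed
  then show "\<exists>U. openin boundary_topology U \<and> \<xi> \<in> U \<and>
      (\<forall>\<eta>\<in>U. boundary_act g \<eta> = \<eta> \<longleftrightarrow> boundary_act g \<xi> = \<xi>)"
    using openin_cylinder[of n \<xi>] by blast
qed

lemma singular_points_eq:
  "singular_points M =
     (\<Union>g\<in>carrier (mealy_group M). {\<xi>. \<forall>n. initial_word \<xi> n \<in> fixed_frontier g})"
proof -
  have "\<xi> \<notin> singular_points M \<longleftrightarrow>
      (\<forall>g\<in>carrier (mealy_group M). \<exists>n. initial_word \<xi> n \<notin> fixed_frontier g)" for \<xi>
  proof -
    have "\<xi> \<notin> singular_points M \<longleftrightarrow> (\<forall>g\<in>carrier (mealy_group M). \<exists>U. openin boundary_topology U \<and>
        \<xi> \<in> U \<and> (\<forall>\<eta>\<in>U. g \<in> stabilizer M \<eta> \<longleftrightarrow> g \<in> stabilizer M \<xi>))"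
      unfolding singular_points_def mem_Collect_eq not_not
      by (intro topcontinuous_at_Sub_topology) (simp_all add: subgroup_stabilizer)
    also have "\<dots> \<longleftrightarrow> (\<forall>g\<in>carrier (mealy_group M). \<exists>n. initial_word \<xi> n \<notin> fixed_frontier g)"
      by (intro ball_cong refl, subst locally_constant_fixing_iff[symmetric])
         (auto simp: stabilizer_def)
    finally show ?thesis .
  qed
  then show ?thesis by blast
qed

theorem theorem4p4:
  fixes M :: "('q::finite, 'a::finite) mealy"
  assumes "invertible_mealy M"
  shows "singular_points M \<in> null_sets uniform_boundary_measure"
  unfolding singular_points_eq
proof (rule null_sets_UN')
  show "countable (carrier (mealy_group M))" using assms by (rule countable_mealy_group)
  fix g assume "g \<in> carrier (mealy_group M)"
  then obtain K where "\<forall>w\<in>fixed_frontier g. \<exists>v. length v = K \<and> w @ v \<notin> fixed_frontier g"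
    using fixed_frontier_escape[OF assms] by blast
  then show "{\<xi>. \<forall>n. initial_word \<xi> n \<in> fixed_frontier g} \<in> null_sets uniform_boundary_measure"
    by (intro null_sets_uniform_escape) blast
qed

end
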